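(* $\mathrm{1Pure} \equiv_2 \mathrm{Pure}$; that is, finding pure equilibria in single player games and finding pure equilibria in bi-matrix games (of arbitrary size, among games possessing a pure equilibrium) have the same degree of discontinuity.
   Context: Representation of reals. Fix a bijection $\nu:\mathbb{N}\to\mathbb{Q}$ with $\nu(0)=0$ such that the usual operations on $\mathbb{Q}$ are computable with respect to $\nu$. A sequence $w\in\mathbb{N}^{\mathbb{N}}$ is a $\rho$-name of $x\in\mathbb{R}$, written $\rho(w)=x$, if $|\nu(w(i))-x|\le 2^{-i}$ for all $i\in\mathbb{N}$. Problems and reducibility. $\mathbb{N}^{\mathbb{N}}$ carries its usual (Baire) topology, countable sets such as $\mathbb{N}$ or finite sets are discrete, products carry the product topology. A problem (multi-valued function) $P$ has a domain $\mathrm{dom}(P)$ of inputs (names) and assigns to each input a nonempty set of admissible outputs (names); $P$ is identified with the set of its choice functions, i.e. all functions $f$ on $\mathrm{dom}(P)$ with $f(w)$ admissible for every $w$. $P\le_2 Q$ holds iff there are continuous partial functions $F,G$ such that for each $g\in Q$ the function $w\mapsto F(w,g(G(w)))$ belongs to $P$ (in particular is defined on $\mathrm{dom}(P)$). $P\equiv_2 Q$ means $P\le_2Q$ and $Q\le_2P$. Games. An $n\times m$ bi-matrix game is a pair $(A,B)$ of real $n\times m$ matrices. A pure equilibrium is a pair $(i,j)\in\{1,\dots,n\}\times\{1,\dots,m\}$ with $A_{ij}\ge A_{kj}$ for all $k\le n$ and $B_{ij}\ge B_{il}$ for all $l\le m$. A name of a game consists of the size $(n,m)$ (readable from a finite prefix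 of the name) followed by $\rho$-names of all entries of $A$ and $B$ (combined by standard tupling of sequences). $\mathrm{Pure}$ is the problem: given a name of a bi-matrix game (of any size $n\times m$, $n,m\ge1$) that has a pure equilibrium, output some pure equilibrium $(i,j)$ (a discrete value). Single player games with $n$ actions are identified with $n\times1$ bi-matrix games: $\mathrm{1Pure}$ is the problem, given $n\ge1$ and $\rho$-names of $n$ real payoffs $a_1,\dots,a_n$, to output some $i\in\{1,\dots,n\}$ with $a_i=\max_k a_k$. *)

theory Defs
  imports "HOL-Analysis.Function_Topology"
begin

section \<open>Representation of real numbers\<close>

text \<open>
  Total recursive functions, where \<open>recursive n f\<close> is meaningful only for the values of \<open>f\<close> on lists of
  length \<open>n\<close>. Minimization is restricted to regular functions, so that all functions are total.
\<close>

inductive recursive :: "nat \<Rightarrow> (nat list \<Rightarrow> nat) \<Rightarrow> bool" where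
  zero: "recursive n (\<lambda>xs. 0)"
| suc: "recursive 1 (\<lambda>xs. Suc (hd xs))"
| proj: "i < n \<Longrightarrow> recursive n (\<lambda>xs. xs ! i)"
| comp: "recursive (length gs) f \<Longrightarrow> \<forall>g\<in>set gs. recursive n g \<Longrightarrow>
    recursive n (\<lambda>xs. f (map (\<lambda>g. g xs) gs))"
| prim: "recursive n f \<Longrightarrow> recursive (Suc (Suc n)) g \<Longrightarrow>
    recursive (Suc n) (\<lambda>xs. rec_nat (f (tl xs)) (\<lambda>k r. g (k # r # tl xs)) (hd xs))"
| mu: "recursive (Suc n) f \<Longrightarrow> \<forall>xs. length xs = n \<longrightarrow> (\<exists>k. f (k # xs) = 0) \<Longrightarrow>
    recursive n (\<lambda>xs. LEAST k. f (k # xs) = 0)"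

definition computable_op :: "(nat \<Rightarrow> rat) \<Rightarrow> (rat \<Rightarrow> rat \<Rightarrow> rat) \<Rightarrow> bool" where
  "computable_op \<nu> h \<longleftrightarrow> (\<exists>f. recursive 2 f \<and> (\<forall>a b. \<nu> (f [a, b]) = h (\<nu> a) (\<nu> b)))"

definition decidable_rel :: "(nat \<Rightarrow> rat) \<Rightarrow> (rat \<Rightarrow> rat \<Rightarrow> bool) \<Rightarrow> bool" where
  "decidable_rel \<nu> R \<longleftrightarrow> (\<exists>f. recursive 2 f \<and> (\<forall>a b. f [a, b] = (if R (\<nu> a) (\<nu> b) then 1 else 0)))"

definition rat_numbering :: "(nat \<Rightarrow> rat) \<Rightarrow> bool" where
  "rat_numbering \<nu> \<longleftrightarrow> bij \<nu> \<and> \<nu> 0 = 0 \<and>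
     computable_op \<nu> (+) \<and> computable_op \<nu> (-) \<and> computable_op \<nu> (*) \<and> computable_op \<nu> (/) \<and>
     decidable_rel \<nu> (\<le>)"

definition rho_name :: "(nat \<Rightarrow> rat) \<Rightarrow> (nat \<Rightarrow> nat) \<Rightarrow> real \<Rightarrow> bool" where
  "rho_name \<nu> w x \<longleftrightarrow> (\<forall>i. \<bar>real_of_rat (\<nu> (w i)) - x\<bar> \<le> 1 / 2 ^ i)"

text \<open>Interleaving of finitely many sequences: \<open>p_0 0, \<dots>, p_(k-1) 0, p_0 1, \<dots>, p_(k-1) 1, \<dots>\<close>\<close>

definition tuple :: "(nat \<Rightarrow> nat) list \<Rightarrow> nat \<Rightarrow> nat" where
  "tuple ps t = (ps ! (t mod length ps)) (t div length ps)"


section \<open>Problems and reducibility\<close>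

text \<open>
  A problem maps each input to its set of admissible outputs; the inputs outside the domain are those
  mapped to the empty set.
\<close>

type_synonym ('a, 'b) problem = "'a \<Rightarrow> 'b set"

definition problem_dom :: "('a, 'b) problem \<Rightarrow> 'a set" where
  "problem_dom P = {w. P w \<noteq> {}}"

definition choice_functions :: "('a, 'b) problem \<Rightarrow> ('a \<rightharpoonup> 'b) set" where
  "choice_functions P = {f. dom f = problem_dom P \<and> (\<forall>w\<in>problem_dom P. the (f w) \<in> P w)}"

definition continuous_partial :: "('a::topological_space \<rightharpoonup> 'b::topological_space) \<Rightarrow> bool" where
  "continuous_partial F \<longleftrightarrow> continuous_on (dom F) (\<lambda>x. the (F x))"

definition reducible2 ::
  "('a::topological_space, 'b::topological_space) problem \<Rightarrow>
   ('c::topological_space, 'd::topological_space) problem \<Rightarrow> bool" (infix "\<le>\<^sub>2" 50) where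
  "P \<le>\<^sub>2 Q \<longleftrightarrow> (\<exists>(F :: 'a \<times> 'd \<rightharpoonup> 'b) (G :: 'a \<rightharpoonup> 'c).
     continuous_partial F \<and> continuous_partial G \<and>
     (\<forall>g\<in>choice_functions Q.
        (\<lambda>w. Option.bind (G w) (\<lambda>v. Option.bind (g v) (\<lambda>u. F (w, u)))) \<in> choice_functions P))"

definition equivalent2 ::
  "('a::topological_space, 'b::topological_space) problem \<Rightarrow>
   ('c::topological_space, 'd::topological_space) problem \<Rightarrow> bool" (infix "\<equiv>\<^sub>2" 50) where
  "P \<equiv>\<^sub>2 Q \<longleftrightarrow> P \<le>\<^sub>2 Q \<and> Q \<le>\<^sub>2 P"


section \<open>Games\<close>

text \<open>
  An \<open>n \<times> m\<close> matrix is a function of a row and a column index, of which only the values on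
  \<open>{1..n} \<times> {1..m}\<close> matter.
\<close>

definition pure_equilibrium ::
  "nat \<Rightarrow> nat \<Rightarrow> (nat \<Rightarrow> nat \<Rightarrow> real) \<Rightarrow> (nat \<Rightarrow> nat \<Rightarrow> real) \<Rightarrow> nat \<times> nat \<Rightarrow> bool" where
  "pure_equilibrium n m A B = (\<lambda>(i, j). i \<in> {1..n} \<and> j \<in> {1..m} \<and>
     (\<forall>k\<in>{1..n}. A i j \<ge> A k j) \<and> (\<forall>l\<in>{1..m}. B i j \<ge> B i l))"

definition entries :: "nat \<Rightarrow> nat \<Rightarrow> (nat \<Rightarrow> nat \<Rightarrow> real) \<Rightarrow> real list" where
  "entries n m A = concat (map (\<lambda>i. map (\<lambda>j. A i j) [1..<Suc m]) [1..<Suc n])"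

text \<open>In the names below, \<open>case_nat n w\<close> is the sequence \<open>w\<close> with \<open>n\<close> prepended.\<close>

definition bimatrix_name ::
  "(nat \<Rightarrow> rat) \<Rightarrow> (nat \<Rightarrow> nat) \<Rightarrow> nat \<Rightarrow> nat \<Rightarrow> (nat \<Rightarrow> nat \<Rightarrow> real) \<Rightarrow> (nat \<Rightarrow> nat \<Rightarrow> real) \<Rightarrow> bool" where
  "bimatrix_name \<nu> w n m A B \<longleftrightarrow> n \<ge> 1 \<and> m \<ge> 1 \<and>
     (\<exists>ps. list_all2 (rho_name \<nu>) ps (entries n m A @ entries n m B) \<and>
           w = case_nat n (case_nat m (tuple ps)))"

definition pure_problem :: "(nat \<Rightarrow> rat) \<Rightarrow> (nat \<Rightarrow> nat, nat \<times> nat) problem" where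
  "pure_problem \<nu> w = {e. \<exists>n m A B. bimatrix_name \<nu> w n m A B \<and> pure_equilibrium n m A B e}"

definition single_name :: "(nat \<Rightarrow> rat) \<Rightarrow> (nat \<Rightarrow> nat) \<Rightarrow> nat \<Rightarrow> (nat \<Rightarrow> real) \<Rightarrow> bool" where
  "single_name \<nu> w n a \<longleftrightarrow> n \<ge> 1 \<and>
     (\<exists>ps. list_all2 (rho_name \<nu>) ps (map a [1..<Suc n]) \<and> w = case_nat n (tuple ps))"

definition one_pure_problem :: "(nat \<Rightarrow> rat) \<Rightarrow> (nat \<Rightarrow> nat, nat) problem" where
  "one_pure_problem \<nu> w = {i. \<exists>n a. single_name \<nu> w n a \<and> i \<in> {1..n} \<and> a i = Max (a ` {1..n})}"

end

theory Submission
  imports Defs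
begin

text \<open>
  A single player game is a game with one column whose second payoff matrix is zero. Conversely, give the
  entry \<open>(i, j)\<close> of a game the payoff
  \<open>min (Min\<^sub>k (A i j - A k j)) (Min\<^sub>l (B i j - B i l))\<close>. It is never positive, and it is zero exactly
  at the pure equilibria. So if there is an equilibrium, the maximizers of this single player game on
  the entries are the equilibria. The payoff depends continuously on the entries of the matrices, hence
  a name of the new game is obtained continuously from a name of the old one.
\<close>

section \<open>Continuity for discrete values and on Baire space\<close>

lemma continuous_on_locally_constant:
  assumes "\<And>x. x \<in> S \<Longrightarrow> \<exists>U. open U \<and> x \<in> U \<and> (\<forall>y\<in>S \<inter> U. f y = f x)"
  shows "continuous_on S f"
  unfolding continuous_on_topological
proof (intro ballI allI impI)
  fix x B
  assume "x \<in> S" "f x \<in> B"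
  with assms obtain U where "open U" "x \<in> U" "\<forall>y\<in>S \<inter> U. f y = f x" by blast
  with \<open>f x \<in> B\<close> show "\<exists>A. open A \<and> x \<in> A \<and> (\<forall>y\<in>S. y \<in> A \<longrightarrow> f y \<in> B)"
    by (intro exI[of _ U]) auto
qed

lemma open_cylinder: "open {v :: nat \<Rightarrow> nat. \<forall>i<N. v i = w i}"
proof -
  have "{v :: nat \<Rightarrow> nat. \<forall>i<N. v i = w i} = Pi UNIV (\<lambda>i. if i < N then {w i} else UNIV)"
    by (auto simp: Pi_iff split: if_splits)
  moreover have "open (Pi UNIV (\<lambda>i. if i < N then {w i} else UNIV))"
    unfolding PiE_UNIV_domain[symmetric] by (rule open_PiE) (auto simp: open_discrete)
  ultimately show ?thesis by simp
qed

text \<open>Continuity into a product is coordinatewise, and each coordinate is discrete, so it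
  suffices that symbol \<open>k\<close> of the output is determined by a finite prefix of the input.
  Its length may depend on \<open>w\<close> and \<open>k\<close>.\<close>

lemma continuous_on_Baire:
  fixes G :: "(nat \<Rightarrow> nat) \<Rightarrow> nat \<Rightarrow> nat"
  assumes "\<And>w k. w \<in> S \<Longrightarrow> \<exists>N. \<forall>v\<in>S. (\<forall>i<N. v i = w i) \<longrightarrow> G v k = G w k"
  shows "continuous_on S G"
proof (rule continuous_on_coordinatewise_then_product, rule continuous_on_locally_constant)
  fix k w
  assume "w \<in> S"
  with assms obtain N where "\<forall>v\<in>S. (\<forall>i<N. v i = w i) \<longrightarrow> G v k = G w k"
    by blast
  then show "\<exists>U. open U \<and> w \<in> U \<and> (\<forall>v\<in>S \<inter> U. G v k = G w k)"
    by (intro exI[of _ "{v. \<forall>i<N. v i = w i}"]) (auto simp: open_cylinder)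
qed

text \<open>Reduces \<open>P \<le>\<^sub>2 Q\<close> to pointwise conditions on total functions: any
  choice function of \<open>Q\<close> picks some \<open>u \<in> Q (G w)\<close>, and
  \<open>sol\<close> covers all such \<open>u\<close>.\<close>

lemma reducible2I:
  fixes P :: "('a::topological_space, 'b::topological_space) problem"
    and Q :: "('c::topological_space, 'd::topological_space) problem"
  assumes G: "continuous_on (problem_dom P) G" and F: "continuous_on UNIV F"
    and dom: "\<And>w. w \<in> problem_dom P \<Longrightarrow> G w \<in> problem_dom Q"
    and sol: "\<And>w u. w \<in> problem_dom P \<Longrightarrow> u \<in> Q (G w) \<Longrightarrow> F (w, u) \<in> P w"
  shows "P \<le>\<^sub>2 Q"
proof -
  \<comment> \<open>\<open>G\<close> is cut down to the domain of \<open>P\<close> because a choice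
    function must be undefined elsewhere.\<close>
  let ?F = "\<lambda>x. Some (F x)" and ?G = "\<lambda>w. if w \<in> problem_dom P then Some (G w) else None"
  have "dom ?G = problem_dom P"
    by (auto split: if_splits)
  then have "continuous_partial ?G"
    using G unfolding continuous_partial_def by (simp cong: continuous_on_cong)
  moreover have "continuous_partial ?F"
    using F by (simp add: continuous_partial_def dom_def)
  moreover have "(\<lambda>w. Option.bind (?G w) (\<lambda>v. Option.bind (g v) (\<lambda>u. ?F (w, u)))) \<in> choice_functions P"
    (is "?f \<in> _") if g: "g \<in> choice_functions Q" for g
  proof -
    have f: "\<exists>u. ?f w = Some u \<and> u \<in> P w" if w: "w \<in> problem_dom P" for w
    proof -
      have "G w \<in> dom g" "the (g (G w)) \<in> Q (G w)"
        using g dom[OF w] by (auto simp: choice_functions_def)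
      then show ?thesis
        using w sol[OF w] by auto
    qed
    moreover have "?f w = None" if "w \<notin> problem_dom P" for w
      using that by simp
    ultimately have "dom ?f = problem_dom P"
      by (metis (no_types, lifting) domD domI domIff subsetI subset_antisym)
    then show ?thesis
      using f unfolding choice_functions_def by fastforce
  qed
  ultimately show ?thesis
    unfolding reducible2_def by blast
qed

section \<open>Names of reals and of games, position by position\<close>

lemma rho_name_unique:
  assumes "rho_name \<nu> w x" "rho_name \<nu> w y"
  shows "x = y"
proof (rule ccontr)
  assume "x \<noteq> y"
  \<comment> \<open>At this precision the two error intervals around the same rational are too short
    to reach both \<open>x\<close> and \<open>y\<close>.\<close>
  then obtain i where i: "(1 / 2) ^ i < \<bar>x - y\<bar> / 2"
    using real_arch_pow_inv[of "\<bar>x - y\<bar> / 2" "1 / 2"] by auto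
  have "\<bar>real_of_rat (\<nu> (w i)) - x\<bar> \<le> (1 / 2) ^ i" "\<bar>real_of_rat (\<nu> (w i)) - y\<bar> \<le> (1 / 2) ^ i"
    using assms by (auto simp: rho_name_def power_one_over)
  moreover have "\<bar>x - y\<bar> \<le> \<bar>real_of_rat (\<nu> (w i)) - x\<bar> + \<bar>real_of_rat (\<nu> (w i)) - y\<bar>"
    by linarith
  ultimately show False using i by argo
qed

lemma div_mod_mult_add:
  fixes a b r :: nat
  assumes "r < b"
  shows "(a * b + r) div b = a" "(a * b + r) mod b = r"
  using assms by auto

text \<open>Component \<open>t\<close> of the interleaving occupies the positions congruent to
  \<open>t\<close> modulo the number of components, so \<open>ps\<close> can be recovered from
  \<open>v\<close>. For empty \<open>xs\<close> the right side would be vacuous while the left fixes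
  \<open>v\<close>.\<close>

lemma ex_tuple_iff:
  assumes "xs \<noteq> []"
  shows "(\<exists>ps. list_all2 (rho_name \<nu>) ps xs \<and> v = tuple ps) \<longleftrightarrow>
    (\<forall>t<length xs. rho_name \<nu> (\<lambda>e. v (e * length xs + t)) (xs ! t))"
    (is "?L \<longleftrightarrow> ?R")
proof
  assume ?L
  then obtain ps where ps: "list_all2 (rho_name \<nu>) ps xs" "v = tuple ps" by blast
  then have "length ps = length xs" by (simp add: list_all2_lengthD)
  then have "(\<lambda>e. v (e * length xs + t)) = ps ! t" if "t < length xs" for t
    using that ps(2) by (simp add: tuple_def div_mod_mult_add)
  with ps(1) show ?R by (simp add: list_all2_conv_all_nth)
next
  assume R: ?R
  define ps where "ps = map (\<lambda>t e. v (e * length xs + t)) [0..<length xs]"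
  have "list_all2 (rho_name \<nu>) ps xs"
    using R by (simp add: ps_def list_all2_conv_all_nth)
  moreover have "v = tuple ps"
    using assms by (auto simp: ps_def tuple_def fun_eq_iff)
  ultimately show ?L by blast
qed

text \<open>Row-major order; the \<open>Suc\<close>s appear because positions count from 0 and
  matrix indices from 1.\<close>

lemma entries_eq: "entries n m A = map (\<lambda>t. A (Suc (t div m)) (Suc (t mod m))) [0..<n * m]"
proof (induction n)
  case 0
  show ?case by (simp add: entries_def)
next
  case (Suc n)
  have "entries (Suc n) m A = entries n m A @ map (A (Suc n)) [1..<Suc m]"
    by (simp add: entries_def)
  also have "map (A (Suc n)) [1..<Suc m] =
      map (\<lambda>t. A (Suc (t div m)) (Suc (t mod m))) [n * m..<n * m + m]"
    by (rule nth_equalityI) (simp_all del: upt_Suc)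
  finally show ?case
    using Suc upt_add_eq_append[of 0 "n * m" m] by (simp add: add.commute)
qed

lemma eq_case_nat_iff: "w = case_nat n v \<longleftrightarrow> w 0 = n \<and> v = (\<lambda>k. w (Suc k))"
  by (auto simp: fun_eq_iff split: nat.splits)

lemma single_name_iff:
  "single_name \<nu> w n a \<longleftrightarrow>
    n \<ge> 1 \<and> w 0 = n \<and> (\<forall>t<n. rho_name \<nu> (\<lambda>e. w (Suc (e * n + t))) (a (Suc t)))"
proof (cases "n \<ge> 1")
  case True
  have "(\<exists>ps. list_all2 (rho_name \<nu>) ps (map a [1..<Suc n]) \<and> w = case_nat n (tuple ps)) \<longleftrightarrow>
      w 0 = n \<and> (\<exists>ps. list_all2 (rho_name \<nu>) ps (map a [1..<Suc n]) \<and> (\<lambda>k. w (Suc k)) = tuple ps)"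
    unfolding eq_case_nat_iff by metis
  with True show ?thesis
    unfolding single_name_def by (subst (asm) ex_tuple_iff) (auto simp del: upt_Suc)
qed (simp add: single_name_def)

text \<open>After the two size symbols the name runs in rounds of length \<open>2 * (n * m)\<close>.
  Round \<open>e\<close> holds the \<open>e\<close>-th approximations, first of all entries of
  \<open>A\<close>, then of \<open>B\<close>.\<close>

lemma bimatrix_name_iff:
  "bimatrix_name \<nu> w n m A B \<longleftrightarrow> n \<ge> 1 \<and> m \<ge> 1 \<and> w 0 = n \<and> w 1 = m \<and>
    (\<forall>t<n * m.
      rho_name \<nu> (\<lambda>e. w (2 + e * (2 * (n * m)) + t)) (A (Suc (t div m)) (Suc (t mod m))) \<and>
      rho_name \<nu> (\<lambda>e. w (2 + e * (2 * (n * m)) + (n * m + t))) (B (Suc (t div m)) (Suc (t mod m))))"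
proof (cases "n \<ge> 1 \<and> m \<ge> 1")
  case True
  let ?xs = "entries n m A @ entries n m B"
  let ?v = "\<lambda>k. w (Suc (Suc k))"
  have len: "length (entries n m A) = n * m" "length (entries n m B) = n * m"
    by (simp_all add: entries_eq)
  have "?xs \<noteq> []" using True by (simp add: entries_eq)
  have "bimatrix_name \<nu> w n m A B \<longleftrightarrow>
      w 0 = n \<and> w 1 = m \<and> (\<exists>ps. list_all2 (rho_name \<nu>) ps ?xs \<and> ?v = tuple ps)"
  proof -
    have "w = case_nat n (case_nat m p) \<longleftrightarrow> w 0 = n \<and> w 1 = m \<and> ?v = p" for p
      by (auto simp: fun_eq_iff split: nat.splits)
    then show ?thesis
      using True by (auto simp: bimatrix_name_def)
  qed
  also have "(\<exists>ps. list_all2 (rho_name \<nu>) ps ?xs \<and> ?v = tuple ps) \<longleftrightarrow>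
      (\<forall>t<n * m + n * m. rho_name \<nu> (\<lambda>e. w (2 + (e * (n * m + n * m) + t))) (?xs ! t))"
    using ex_tuple_iff[OF \<open>?xs \<noteq> []\<close>, of \<nu> ?v] by (simp add: len)
  also have "\<dots> \<longleftrightarrow> (\<forall>t<n * m.
      rho_name \<nu> (\<lambda>e. w (2 + (e * (n * m + n * m) + t))) (?xs ! t) \<and>
      rho_name \<nu> (\<lambda>e. w (2 + (e * (n * m + n * m) + (n * m + t)))) (?xs ! (n * m + t)))"
    (is "(\<forall>t<_. ?Q t) \<longleftrightarrow> _")
  proof -
    have "(\<forall>t<k + k. Q t) \<longleftrightarrow> (\<forall>t<k. Q t \<and> Q (k + t))" for Q and k :: nat
      by (metis add_less_cancel_left le_add_diff_inverse not_le trans_less_add1)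
    from this[of "n * m" ?Q] show ?thesis .
  qed
  finally show ?thesis
    using True by (simp add: nth_append len entries_eq mult_2 add.assoc)
qed (auto simp: bimatrix_name_def)


section \<open>Single player games as bi-matrix games\<close>

text \<open>Each round has length \<open>2 * w 0\<close>: its first half copies a round of
  \<open>w\<close>, its second half is filled with the code 0, naming the zero payoffs of the second
  player.\<close>

definition one_column :: "(nat \<Rightarrow> nat) \<Rightarrow> nat \<Rightarrow> nat" where
  "one_column w = case_nat (w 0) (case_nat 1 (\<lambda>k.
     if k mod (2 * w 0) < w 0 then w (Suc (k div (2 * w 0) * w 0 + k mod (2 * w 0))) else 0))"

lemma continuous_one_column: "continuous_on S one_column"
proof (rule continuous_on_Baire)
  fix w :: "nat \<Rightarrow> nat" and k :: nat
  \<comment> \<open>\<open>?j\<close> discards the two size symbols; for \<open>k < 2\<close> the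
    truncation is harmless, since these symbols depend on \<open>w 0\<close> at most.
    \<open>?N\<close> just exceeds the position of \<open>w\<close> that is read.\<close>
  let ?j = "k - 2"
  let ?N = "2 + (?j div (2 * w 0) * w 0 + ?j mod (2 * w 0))"
  have "one_column v k = one_column w k" if "\<forall>i<?N. v i = w i" for v
  proof -
    have "v 0 = w 0"
      "v (Suc (?j div (2 * w 0) * w 0 + ?j mod (2 * w 0))) =
       w (Suc (?j div (2 * w 0) * w 0 + ?j mod (2 * w 0)))"
      using that by auto
    then show ?thesis
      by (auto simp: one_column_def numeral_2_eq_2 split: nat.splits)
  qed
  then show "\<exists>N. \<forall>v\<in>S. (\<forall>i<N. v i = w i) \<longrightarrow> one_column v k = one_column w k"
    by blast
qed

lemma rho_name_zero: "\<nu> 0 = 0 \<Longrightarrow> rho_name \<nu> (\<lambda>_. 0) 0"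
  by (simp add: rho_name_def)

lemma bimatrix_name_one_column:
  assumes "\<nu> 0 = 0" and "single_name \<nu> w n a"
  shows "bimatrix_name \<nu> (one_column w) n 1 (\<lambda>i j. a i) (\<lambda>i j. 0)"
proof -
  have n: "n \<ge> 1" "w 0 = n"
    and a: "\<And>t. t < n \<Longrightarrow> rho_name \<nu> (\<lambda>e. w (Suc (e * n + t))) (a (Suc t))"
    using assms(2) by (auto simp: single_name_iff)
  have "one_column w (2 + e * (2 * n) + r) = (if r < n then w (Suc (e * n + r)) else 0)"
    if "r < 2 * n" for e r
  proof -
    have "one_column w (2 + e * (2 * n) + r) = one_column w (Suc (Suc (e * (2 * n) + r)))"
      by simp
    also have "\<dots> = (if r < n then w (Suc (e * n + r)) else 0)"
      by (simp only: one_column_def n nat.case div_mod_mult_add[OF that])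
    finally show ?thesis .
  qed
  then show ?thesis
    using n a by (auto simp: bimatrix_name_iff one_column_def[of w] rho_name_zero[where \<nu> = \<nu>, OF assms(1)])
qed

lemma Max_image_eq_iff:
  fixes a :: "'a \<Rightarrow> 'b::linorder"
  assumes "finite I" "i \<in> I"
  shows "a i = Max (a ` I) \<longleftrightarrow> (\<forall>k\<in>I. a k \<le> a i)"
  using assms eq_Max_iff[of "a ` I" "a i"] by auto

lemma single_name_max_exists:
  assumes "single_name \<nu> w n a"
  obtains i where "i \<in> {1..n}" "\<And>k. k \<in> {1..n} \<Longrightarrow> a k \<le> a i"
proof -
  have ne: "{1..n} \<noteq> {}"
    using assms by (simp add: single_name_def)
  then have "Max (a ` {1..n}) \<in> a ` {1..n}" by (intro Max_in) auto
  then show ?thesis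
    using that by (metis Max_ge finite_atLeastAtMost finite_imageI image_eqI image_iff)
qed

text \<open>With a constant second payoff and a single column, only the first player's condition
  restricts the equilibria, so they are the pairs of a maximizer and 1.\<close>

lemma one_pure_le_pure:
  assumes "\<nu> 0 = 0"
  shows "one_pure_problem \<nu> \<le>\<^sub>2 pure_problem \<nu>"
proof (rule reducible2I[where G = one_column and F = "\<lambda>(w, i, j). i"])
  show "continuous_on UNIV (\<lambda>(w :: nat \<Rightarrow> nat, i :: nat, j :: nat). i)"
    unfolding case_prod_unfold by (intro continuous_intros)
next
  fix w
  assume "w \<in> problem_dom (one_pure_problem \<nu>)"
  then obtain n a where name: "single_name \<nu> w n a"
    by (auto simp: problem_dom_def one_pure_problem_def)
  note bname = bimatrix_name_one_column[OF assms name]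
  obtain i where "i \<in> {1..n}" "\<And>k. k \<in> {1..n} \<Longrightarrow> a k \<le> a i"
    using single_name_max_exists[OF name] by blast
  then have "pure_equilibrium n 1 (\<lambda>i j. a i) (\<lambda>i j. 0) (i, 1)"
    by (auto simp: pure_equilibrium_def)
  with bname show "one_column w \<in> problem_dom (pure_problem \<nu>)"
    unfolding problem_dom_def pure_problem_def by blast
  fix u
  assume "u \<in> pure_problem \<nu> (one_column w)"
  \<comment> \<open>\<open>u\<close> solves some game with this name, not a priori the constructed
    one. The sizes are read from the prefix and the entries agree by
    \<open>rho_name_unique\<close>.\<close>
  then obtain n' m' A B where bname': "bimatrix_name \<nu> (one_column w) n' m' A B"
    and eq: "pure_equilibrium n' m' A B u"
    by (auto simp: pure_problem_def)
  have [simp]: "n' = n" "m' = 1"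
    using bname bname' by (auto simp: bimatrix_name_iff)
  have "A (Suc t) 1 = a (Suc t)" if "t < n" for t
    using bname bname' that unfolding bimatrix_name_iff
    by (auto intro: rho_name_unique)
  then have A: "A k 1 = a k" if "k \<in> {1..n}" for k
    using that by (cases k) auto
  obtain i where u: "u = (i, 1)" "i \<in> {1..n}" "\<forall>k\<in>{1..n}. A k 1 \<le> A i 1"
    using eq by (cases u) (auto simp: pure_equilibrium_def)
  then have "\<forall>k\<in>{1..n}. a k \<le> a i"
    using A by simp
  with u(2) have "a i = Max (a ` {1..n})"
    by (simp add: Max_image_eq_iff)
  then show "(case (w, u) of (w, i, j) \<Rightarrow> i) \<in> one_pure_problem \<nu> w"
    using name u by (auto simp: one_pure_problem_def)
qed (rule continuous_one_column)


section \<open>The single player game of a bi-matrix game\<close>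

text \<open>The negative of the largest gain that either player can obtain by deviating alone from
  \<open>(i, j)\<close>.\<close>

definition payoff ::
  "nat \<Rightarrow> nat \<Rightarrow> (nat \<Rightarrow> nat \<Rightarrow> real) \<Rightarrow> (nat \<Rightarrow> nat \<Rightarrow> real) \<Rightarrow> nat \<Rightarrow> nat \<Rightarrow> real" where
  "payoff n m A B i j =
     min (Min ((\<lambda>k. A i j - A k j) ` {1..n})) (Min ((\<lambda>l. B i j - B i l) ` {1..m}))"

text \<open>The form \<open>\<ge> 0\<close> suits the reduction: a maximizer has at least the payoff
  of an equilibrium, so it inherits this bound.\<close>

lemma pure_equilibrium_iff_payoff:
  assumes "i \<in> {1..n}" "j \<in> {1..m}"
  shows "pure_equilibrium n m A B (i, j) \<longleftrightarrow> payoff n m A B i j \<ge> 0"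
proof -
  have "{1..n} \<noteq> {}" "{1..m} \<noteq> {}" using assms by auto
  then show ?thesis
    using assms by (auto simp: pure_equilibrium_def payoff_def)
qed

text \<open>The minimum is 1-Lipschitz for the supremum distance. The one-sided estimate is proved
  for arbitrary functions and used in both orders.\<close>

lemma abs_Min_diff_le:
  fixes f g :: "'a \<Rightarrow> real"
  assumes "finite I" "I \<noteq> {}" and e: "\<And>i. i \<in> I \<Longrightarrow> \<bar>f i - g i\<bar> \<le> e"
  shows "\<bar>Min (f ` I) - Min (g ` I)\<bar> \<le> e"
proof -
  have *: "Min (f ` I) - e \<le> Min (g ` I)"
    if close: "\<And>i. i \<in> I \<Longrightarrow> \<bar>f i - g i\<bar> \<le> e" for f g :: "'a \<Rightarrow> real"
  proof -
    have "Min (f ` I) - e \<le> g i" if i: "i \<in> I" for i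
    proof -
      have "Min (f ` I) \<le> f i" using assms(1) i by simp
      with close[OF i] show ?thesis by linarith
    qed
    with assms(1,2) show ?thesis by simp
  qed
  show ?thesis
    using *[of f g] *[of g f] e by (fastforce simp: abs_minus_commute)
qed

text \<open>A difference of two entries moves by at most \<open>2 * e\<close>, and minima do not
  enlarge this.\<close>

lemma payoff_diff_le:
  assumes "i \<in> {1..n}" "j \<in> {1..m}"
    and A: "\<And>i j. i \<in> {1..n} \<Longrightarrow> j \<in> {1..m} \<Longrightarrow> \<bar>A i j - A' i j\<bar> \<le> e"
    and B: "\<And>i j. i \<in> {1..n} \<Longrightarrow> j \<in> {1..m} \<Longrightarrow> \<bar>B i j - B' i j\<bar> \<le> e"
  shows "\<bar>payoff n m A B i j - payoff n m A' B' i j\<bar> \<le> 2 * e"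
proof -
  have "\<bar>Min ((\<lambda>k. A i j - A k j) ` {1..n}) - Min ((\<lambda>k. A' i j - A' k j) ` {1..n})\<bar> \<le> 2 * e"
    using assms(1,2) by (intro abs_Min_diff_le) (use A[of i j] A[of _ j] in \<open>fastforce+\<close>)
  moreover
  have "\<bar>Min ((\<lambda>l. B i j - B i l) ` {1..m}) - Min ((\<lambda>l. B' i j - B' i l) ` {1..m})\<bar> \<le> 2 * e"
    using assms(1,2) by (intro abs_Min_diff_le) (use B[of i j] B[of i] in \<open>fastforce+\<close>)
  ultimately show ?thesis
    unfolding payoff_def by linarith
qed

lemma payoff_cong:
  assumes "i \<in> {1..n}" "j \<in> {1..m}"
    and "\<And>i j. i \<in> {1..n} \<Longrightarrow> j \<in> {1..m} \<Longrightarrow> A i j = A' i j"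
    and "\<And>i j. i \<in> {1..n} \<Longrightarrow> j \<in> {1..m} \<Longrightarrow> B i j = B' i j"
  shows "payoff n m A B i j = payoff n m A' B' i j"
  using payoff_diff_le[OF assms(1,2), of A A' 0 B B'] assms(3,4) by simp

text \<open>The choice may vary wildly with \<open>x\<close>. Continuity survives because it is
  applied only to values \<open>approx_payoff\<close> that a finite prefix of the name determines
  exactly.\<close>

definition rat_code :: "(nat \<Rightarrow> rat) \<Rightarrow> nat \<Rightarrow> real \<Rightarrow> nat" where
  "rat_code \<nu> e x = (SOME t. \<bar>real_of_rat (\<nu> t) - x\<bar> \<le> 1 / 2 ^ e)"

lemma rat_code:
  assumes "surj \<nu>"
  shows "\<bar>real_of_rat (\<nu> (rat_code \<nu> e x)) - x\<bar> \<le> 1 / 2 ^ e"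
proof -
  obtain q where "x < real_of_rat q" "real_of_rat q < x + 1 / 2 ^ e"
    using of_rat_dense[of x "x + 1 / 2 ^ e"] by auto
  moreover obtain t where "q = \<nu> t"
    using assms by (metis surjD)
  ultimately have "\<bar>real_of_rat (\<nu> t) - x\<bar> \<le> 1 / 2 ^ e" by auto
  then show ?thesis
    unfolding rat_code_def by (rule someI)
qed

text \<open>
  The approximations with error \<open>1 / 2 ^ e\<close> that a name \<open>w\<close> contains for the entries of the first
  (\<open>c = 0\<close>) and second (\<open>c = 1\<close>) matrix.
\<close>

definition approx_entry :: "(nat \<Rightarrow> rat) \<Rightarrow> (nat \<Rightarrow> nat) \<Rightarrow> nat \<Rightarrow> nat \<Rightarrow> nat \<Rightarrow> nat \<Rightarrow> real" where
  "approx_entry \<nu> w e c i j = real_of_rat (\<nu> (w (2 + e * (2 * (w 0 * w 1)) +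
     (c * (w 0 * w 1) + ((i - 1) * w 1 + (j - 1))))))"

definition approx_payoff :: "(nat \<Rightarrow> rat) \<Rightarrow> (nat \<Rightarrow> nat) \<Rightarrow> nat \<Rightarrow> nat \<Rightarrow> real" where
  "approx_payoff \<nu> w e t = payoff (w 0) (w 1) (approx_entry \<nu> w e 0) (approx_entry \<nu> w e 1)
     (Suc (t div w 1)) (Suc (t mod w 1))"

text \<open>
  Of the two additional digits of precision, one compensates for the subtractions in the payoff and one
  for the rounding to a rational number.
\<close>

definition payoff_game :: "(nat \<Rightarrow> rat) \<Rightarrow> (nat \<Rightarrow> nat) \<Rightarrow> nat \<Rightarrow> nat" where
  "payoff_game \<nu> w = case_nat (w 0 * w 1) (\<lambda>k. let e = k div (w 0 * w 1) in
     rat_code \<nu> (Suc e) (approx_payoff \<nu> w (Suc (Suc e)) (k mod (w 0 * w 1))))"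

section \<open>Continuity and correctness of the payoff game\<close>

lemma index_less:
  fixes i j n m :: nat
  assumes "i \<in> {1..n}" "j \<in> {1..m}"
  shows "(i - 1) * m + (j - 1) < n * m"
proof -
  have "(i - 1) * m + (j - 1) < (i - 1) * m + m" using assms by auto
  also have "\<dots> = i * m" using assms by (cases i) auto
  also have "\<dots> \<le> n * m" using assms by auto
  finally show ?thesis .
qed

lemma action_in_range:
  fixes t n m :: nat
  assumes "t < n * m"
  shows "Suc (t div m) \<in> {1..n}" "Suc (t mod m) \<in> {1..m}"
proof -
  have "m > 0" using assms by (cases m) auto
  then show "Suc (t div m) \<in> {1..n}" "Suc (t mod m) \<in> {1..m}"
    using assms by (auto simp: less_mult_imp_div_less Suc_le_eq)
qed

text \<open>The prefix consists of the two size symbols and rounds 0 to \<open>e\<close>, hence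
  contains every symbol consulted at precision \<open>e\<close>.\<close>

lemma approx_payoff_cong:
  assumes "w 0 \<ge> 1" "w 1 \<ge> 1" "t < w 0 * w 1"
    and "\<forall>k<2 + (e + 1) * (2 * (w 0 * w 1)). v k = w k"
  shows "approx_payoff \<nu> v e t = approx_payoff \<nu> w e t"
proof -
  have [simp]: "v 0 = w 0" "v 1 = w 1" "v (Suc 0) = w (Suc 0)" using assms(4) by auto
  have entry: "approx_entry \<nu> v e c i j = approx_entry \<nu> w e c i j"
    if "i \<in> {1..w 0}" "j \<in> {1..w 1}" "c \<le> 1" for c i j
  proof -
    have "c * (w 0 * w 1) \<le> w 0 * w 1" using that(3) by (cases c) auto
    with index_less[OF that(1,2)]
    have "2 + e * (2 * (w 0 * w 1)) + (c * (w 0 * w 1) + ((i - 1) * w 1 + (j - 1)))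
        < 2 + (e + 1) * (2 * (w 0 * w 1))"
      unfolding add_mult_distrib by linarith
    with assms(4) show ?thesis by (simp add: approx_entry_def)
  qed
  show ?thesis
    unfolding approx_payoff_def \<open>v 0 = w 0\<close> \<open>v 1 = w 1\<close>
    by (rule payoff_cong[OF action_in_range[OF assms(3)]]) (simp_all add: entry)
qed

lemma continuous_payoff_game:
  assumes "\<And>w. w \<in> S \<Longrightarrow> w 0 \<ge> 1 \<and> w 1 \<ge> 1"
  shows "continuous_on S (payoff_game \<nu>)"
proof (rule continuous_on_Baire)
  fix w :: "nat \<Rightarrow> nat" and k
  assume "w \<in> S"
  with assms have w: "w 0 \<ge> 1" "w 1 \<ge> 1" by auto
  \<comment> \<open>Symbol \<open>k > 0\<close> lies in round \<open>(k - 1) div (w 0 * w 1)\<close>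
    and uses the input round two later, with which the prefix of length \<open>?N\<close> ends.
    Symbol 0 depends on the sizes only.\<close>
  let ?e = "Suc (Suc ((k - 1) div (w 0 * w 1)))"
  let ?N = "2 + (?e + 1) * (2 * (w 0 * w 1))"
  have "payoff_game \<nu> v k = payoff_game \<nu> w k" if v: "\<forall>i<?N. v i = w i" for v
  proof -
    have "v 0 = w 0" "v 1 = w 1" using v by auto
    moreover have "approx_payoff \<nu> v ?e ((k - 1) mod (w 0 * w 1)) =
        approx_payoff \<nu> w ?e ((k - 1) mod (w 0 * w 1))"
      using w v by (intro approx_payoff_cong) auto
    ultimately show ?thesis
      by (auto simp: payoff_game_def Let_def split: nat.splits)
  qed
  then show "\<exists>N. \<forall>v\<in>S. (\<forall>i<N. v i = w i) \<longrightarrow> payoff_game \<nu> v k = payoff_game \<nu> w k"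
    by blast
qed

lemma approx_entry_diff_le:
  assumes "bimatrix_name \<nu> w n m A B" "i \<in> {1..n}" "j \<in> {1..m}"
  shows "\<bar>approx_entry \<nu> w e 0 i j - A i j\<bar> \<le> 1 / 2 ^ e"
    and "\<bar>approx_entry \<nu> w e 1 i j - B i j\<bar> \<le> 1 / 2 ^ e"
proof -
  \<comment> \<open>The position of \<open>(i, j)\<close> in row-major order, counted from
    0.\<close>
  define t where "t = (i - 1) * m + (j - 1)"
  have "t < n * m" unfolding t_def by (rule index_less[OF assms(2,3)])
  moreover have "j - 1 < m" using assms(3) by auto
  then have "Suc (t div m) = i" "Suc (t mod m) = j"
    using assms(2,3) unfolding t_def by (simp_all only: div_mod_mult_add) auto
  ultimately have
    "rho_name \<nu> (\<lambda>e. w (2 + e * (2 * (n * m)) + t)) (A i j)"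
    "rho_name \<nu> (\<lambda>e. w (2 + e * (2 * (n * m)) + (n * m + t))) (B i j)"
    and w: "w 0 = n" "w 1 = m"
    using assms(1) unfolding bimatrix_name_iff by auto
  then show "\<bar>approx_entry \<nu> w e 0 i j - A i j\<bar> \<le> 1 / 2 ^ e"
    "\<bar>approx_entry \<nu> w e 1 i j - B i j\<bar> \<le> 1 / 2 ^ e"
    by (simp_all only: approx_entry_def rho_name_def w t_def) simp_all
qed

lemma single_name_payoff_game:
  assumes "surj \<nu>" and name: "bimatrix_name \<nu> w n m A B"
  shows "single_name \<nu> (payoff_game \<nu> w) (n * m)
    (\<lambda>s. payoff n m A B (Suc ((s - 1) div m)) (Suc ((s - 1) mod m)))"
proof -
  have nm: "n \<ge> 1" "m \<ge> 1" and w: "w 0 = n" "w 1 = m"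
    using name by (auto simp: bimatrix_name_iff)
  have "\<bar>real_of_rat (\<nu> (payoff_game \<nu> w (Suc (e * (n * m) + t)))) -
      payoff n m A B (Suc (t div m)) (Suc (t mod m))\<bar> \<le> 1 / 2 ^ e"
    if t: "t < n * m" for t e
  proof -
    let ?y = "approx_payoff \<nu> w (Suc (Suc e)) t"
    have "payoff_game \<nu> w (Suc (e * (n * m) + t)) = rat_code \<nu> (Suc e) ?y"
      by (simp only: payoff_game_def nat.case w Let_def div_mod_mult_add[OF t])
    then have "\<bar>real_of_rat (\<nu> (payoff_game \<nu> w (Suc (e * (n * m) + t)))) - ?y\<bar> \<le> 1 / 2 ^ Suc e"
      using rat_code[OF assms(1), of "Suc e" ?y] by simp
    moreover have "\<bar>?y - payoff n m A B (Suc (t div m)) (Suc (t mod m))\<bar> \<le> 2 * (1 / 2 ^ Suc (Suc e))"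
      unfolding approx_payoff_def w
      by (rule payoff_diff_le[OF action_in_range[OF t]]) (rule approx_entry_diff_le[OF name]; assumption)+
    \<comment> \<open>The error budget: rounding to a rational plus twice the error of the
      entries.\<close>
    moreover have "1 / 2 ^ Suc e + 2 * (1 / 2 ^ Suc (Suc e)) = (1 / 2 ^ e :: real)"
      by simp
    ultimately show ?thesis by linarith
  qed
  then have "rho_name \<nu> (\<lambda>e. payoff_game \<nu> w (Suc (e * (n * m) + t)))
      (payoff n m A B (Suc (t div m)) (Suc (t mod m)))" if "t < n * m" for t
    using that by (simp add: rho_name_def)
  moreover have "payoff_game \<nu> w 0 = n * m"
    by (simp only: payoff_game_def nat.case w)
  ultimately show ?thesis
    using nm by (simp add: single_name_iff)
qed

text \<open>\<open>F\<close> decodes an action number, which starts at 1, into its row-major pair;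
  from \<open>w\<close> it takes only the number of columns.\<close>

lemma pure_le_one_pure:
  assumes "surj \<nu>"
  shows "pure_problem \<nu> \<le>\<^sub>2 one_pure_problem \<nu>"
proof (rule reducible2I[where G = "payoff_game \<nu>"
      and F = "\<lambda>(w, s). (Suc ((s - 1) div w 1), Suc ((s - 1) mod w 1))"])
  show "continuous_on (problem_dom (pure_problem \<nu>)) (payoff_game \<nu>)"
    by (rule continuous_payoff_game)
      (auto simp: problem_dom_def pure_problem_def bimatrix_name_iff)
next
  show "continuous_on UNIV
      (\<lambda>(w :: nat \<Rightarrow> nat, s). (Suc ((s - 1) div w 1), Suc ((s - 1) mod w 1)))"
  proof (rule continuous_on_locally_constant)
    fix x :: "(nat \<Rightarrow> nat) \<times> nat"
    \<comment> \<open>Fixing the first two symbols of the name and the discrete action number fixes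
      the value of \<open>F\<close>.\<close>
    let ?U = "{v. \<forall>i<2. v i = fst x i} \<times> {snd x}"
    have "open ?U"
      by (intro open_Times open_cylinder) (simp add: open_discrete)
    then show "\<exists>U. open U \<and> x \<in> U \<and> (\<forall>y\<in>UNIV \<inter> U.
        (case y of (w, s) \<Rightarrow> (Suc ((s - 1) div w 1), Suc ((s - 1) mod w 1))) =
        (case x of (w, s) \<Rightarrow> (Suc ((s - 1) div w 1), Suc ((s - 1) mod w 1))))"
      by (intro exI[of _ ?U]) (auto simp: case_prod_unfold mem_Times_iff)
  qed
next
  fix w
  assume "w \<in> problem_dom (pure_problem \<nu>)"
  then obtain n m A B e where name: "bimatrix_name \<nu> w n m A B" and eq: "pure_equilibrium n m A B e"
    by (auto simp: problem_dom_def pure_problem_def)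
  obtain i j where ij: "e = (i, j)" "i \<in> {1..n}" "j \<in> {1..m}"
    using eq by (cases e) (auto simp: pure_equilibrium_def)
  have w: "w 1 = m" using name by (simp add: bimatrix_name_iff)
  define a where "a s = payoff n m A B (Suc ((s - 1) div m)) (Suc ((s - 1) mod m))" for s
  have sname: "single_name \<nu> (payoff_game \<nu> w) (n * m) a"
    using single_name_payoff_game[OF assms name] by (simp add: a_def[abs_def])
  \<comment> \<open>A finite single player game always has a maximizer, so the constructed name is a
    legitimate input.\<close>
  obtain s where "s \<in> {1..n * m}" "\<And>k. k \<in> {1..n * m} \<Longrightarrow> a k \<le> a s"
    using single_name_max_exists[OF sname] by blast
  then have "s \<in> one_pure_problem \<nu> (payoff_game \<nu> w)"
    using sname Max_image_eq_iff[of "{1..n * m}" s a] unfolding one_pure_problem_def by blast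
  then show "payoff_game \<nu> w \<in> problem_dom (one_pure_problem \<nu>)"
    by (auto simp: problem_dom_def)
  fix u
  assume "u \<in> one_pure_problem \<nu> (payoff_game \<nu> w)"
  then obtain n' a' where sname': "single_name \<nu> (payoff_game \<nu> w) n' a'"
    and u: "u \<in> {1..n'}" and max: "a' u = Max (a' ` {1..n'})"
    by (auto simp: one_pure_problem_def)
  have n': "n' = n * m"
    using sname sname' by (auto simp: single_name_iff)
  have "a' (Suc t) = a (Suc t)" if "t < n * m" for t
    using sname sname' that unfolding single_name_iff n' by (auto intro: rho_name_unique)
  then have a': "a' k = a k" if "k \<in> {1..n * m}" for k
    using that by (cases k) auto
  \<comment> \<open>The action of the equilibrium known to exist. Its payoff is at least 0, hence so
    is that of the maximizer \<open>u\<close>, which therefore also encodes an equilibrium.\<close>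
  define s where "s = Suc ((i - 1) * m + (j - 1))"
  have s: "s \<in> {1..n * m}"
    using index_less[OF ij(2,3)] by (simp add: s_def Suc_le_eq)
  have "j - 1 < m" using ij(3) by auto
  then have "Suc ((s - 1) div m) = i" "Suc ((s - 1) mod m) = j"
    using ij(2,3) unfolding s_def diff_Suc_1 by (simp_all only: div_mod_mult_add) auto
  then have "a s \<ge> 0"
    using eq ij pure_equilibrium_iff_payoff[OF ij(2,3)] by (simp add: a_def)
  also have "a s \<le> a u"
    using max u s a' Max_image_eq_iff[of "{1..n'}" u a'] by (auto simp: n')
  finally have "payoff n m A B (Suc ((u - 1) div m)) (Suc ((u - 1) mod m)) \<ge> 0"
    by (simp add: a_def)
  moreover have "u - 1 < n * m" using u n' by auto
  ultimately have "pure_equilibrium n m A B (Suc ((u - 1) div m), Suc ((u - 1) mod m))"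
    by (subst pure_equilibrium_iff_payoff) (auto simp only: action_in_range)
  with name show "(case (w, u) of (w, s) \<Rightarrow> (Suc ((s - 1) div w 1), Suc ((s - 1) mod w 1)))
      \<in> pure_problem \<nu> w"
    unfolding pure_problem_def prod.case w by blast
qed

theorem corollary11:
  fixes \<nu> :: "nat \<Rightarrow> rat"
  assumes "rat_numbering \<nu>"
  shows "one_pure_problem \<nu> \<equiv>\<^sub>2 pure_problem \<nu>"
  \<comment> \<open>\<open>\<nu> 0 = 0\<close> serves the first reduction, and surjectivity, from
    bijectivity, the second.\<close>
  using assms one_pure_le_pure pure_le_one_pure
  unfolding equivalent2_def rat_numbering_def by (auto dest: bij_is_surj)

end
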